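(* Let $f_1, f_2:\mathbb{R}^n\to \mathbb{R}$ be directed subdifferentiable at $x\in \mathbb{R}^n$ and let $\alpha,\beta\in\mathbb{R}$. Then $f= \alpha f_1+\beta f_2$ is also directed subdifferentiable at $x$ and $$\overrightarrow{\partial} f(x) = \alpha\,\overrightarrow{\partial} f_1(x)+\beta\,\overrightarrow{\partial} f_2(x).$$
   Context: Notation. $\mathcal{S}_{n-1}$ is the Euclidean unit sphere in $\mathbb{R}^n$ (so $\mathcal{S}_0=\{-1,1\}$). The (Dini) directional derivative of $f:\mathbb{R}^n\to\mathbb{R}$ at $x$ in direction $l$ is $f'(x;l)=\lim_{t\downarrow 0}\frac{f(x+tl)-f(x)}{t}$. For $n\ge 2$ and $l\in\mathcal{S}_{n-1}$, $\Pi_{n-1,l}:\mathbb{R}^n\to\mathbb{R}^{n-1}$ is a fixed linear map that maps the orthogonal complement of $l$ isometrically onto $\mathbb{R}^{n-1}$ and maps $l$ to $0$; its transpose $\Pi_{n-1,l}^\top:\mathbb{R}^{n-1}\to\mathbb{R}^n$ maps $\mathbb{R}^{n-1}$ onto the orthogonal complement of $l$ and inverts the restriction of $\Pi_{n-1,l}$ to that complement. Directed subdifferentiable functions. A function $f:\mathbb{R}\to\mathbb{R}$ is $M$-directed subdifferentiable at $x\in\mathbb{R}$ if $f'(x;1)$ and $f'(x;-1)$ exist and $\max\{|f'(x;-1)|,|f'(x;1)|\}\le M$. A function $f:\mathbb{R}^n\to\mathbb{R}$, $n\ge2$, is $M$-directed subdifferentiable at $x\in\mathbb{R}^n$ if $f'(x;l)$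 exists for every $l$, is continuous as a function of $l$, satisfies $\max_{l\in\mathcal{S}_{n-1}}|f'(x;l)|\le M$, and for every $l\in\mathcal{S}_{n-1}$ the function $f_l:\mathbb{R}^{n-1}\to\mathbb{R}$, $f_l(\cdot)=f'(x;l+\Pi_{n-1,l}^\top(\cdot))$, is $M$-directed subdifferentiable at $0_{n-1}$. $f$ is directed subdifferentiable at $x$ if it is $M$-directed subdifferentiable at $x$ for some $M\ge 0$. Directed sets. For $n=1$ a directed set is a directed interval $\overrightarrow{[a,b]}$ with $a,b\in\mathbb{R}$ arbitrary, identified with the pair $(a_1(-1),a_1(1))=(-a,b)$; its norm is $\max\{|a_1(-1)|,|a_1(1)|\}$. For $n\ge2$ a directed set is a family $\overrightarrow{A}=(\overrightarrow{A_{n-1}(l)},a_n(l))_{l\in\mathcal{S}_{n-1}}$ with $a_n:\mathcal{S}_{n-1}\to\mathbb{R}$ continuous and $l\mapsto\overrightarrow{A_{n-1}(l)}$ a map into $(n-1)$-dimensional directed sets, uniformly bounded in norm; its norm is $\max\{\sup_l\|\overrightarrow{A_{n-1}(l)}\|,\max_l|a_n(l)|\}$. Linear operations are componentwise and recursive: $\alpha\overrightarrow{[a,b]}+\beta\overrightarrow{[c,d]}=\overrightarrow{[\alpha a+\beta c,\alpha b+\beta d]}$ for all $\alpha,\beta\in\mathbb{R}$ and, for $n\ge2$, $\overrightarrow{A}+\overrightarrow{B}=(\overrightarrow{A_{n-1}(l)}+\overrightarrow{B_{n-1}(l)},a_n(l)+b_n(l))_{l}$ and $\lambda\overrightarrow{A}=(\lambda\overrightarrow{A_{n-1}(l)},\lambda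 a_n(l))_{l}$ for $\lambda\in\mathbb{R}$. Directed subdifferential. For $f$ directed subdifferentiable at $x$: if $n=1$, $\overrightarrow{\partial} f(x)=\overrightarrow{[-f'(x;-1),f'(x;1)]}=(f'(x;l))_{l=\pm1}$; if $n\ge2$, $\overrightarrow{\partial} f(x)=(\overrightarrow{\partial} f_l(0),f'(x;l))_{l\in\mathcal{S}_{n-1}}$ with $f_l(\cdot)=f'(x;l+\Pi_{n-1,l}^\top(\cdot))$. *)

theory Defs
  imports "HOL-Analysis.Analysis"
begin

text \<open>
  The constructions below recurse over the dimension, so \<open>\<real>\<^sup>n\<close> is the carrier of the library space
  \<^term>\<open>Euclidean_space n\<close>: sequences \<^typ>\<open>nat \<Rightarrow> real\<close> that vanish from index \<open>n\<close> on.  A function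
  \<open>\<real>\<^sup>n \<rightarrow> \<real>\<close> is an \<open>f :: (nat \<Rightarrow> real) \<Rightarrow> real\<close> of which only the values on that carrier are used.
  \<^term>\<open>nsphere m\<close> is the \<open>m\<close>-dimensional sphere, hence the index shift in \<open>usphere\<close>.
\<close>

type_synonym rvec = "nat \<Rightarrow> real"

abbreviation Rn :: "nat \<Rightarrow> rvec set" where
  "Rn n \<equiv> topspace (Euclidean_space n)"

abbreviation usphere :: "nat \<Rightarrow> rvec set" where
  "usphere n \<equiv> topspace (nsphere (n - 1))"

abbreviation zero_vec :: rvec where
  "zero_vec \<equiv> (\<lambda>_. 0)"

text \<open>The identification of \<open>\<real>\<close> and \<open>\<real>\<^sup>1\<close>.\<close>

definition real_vec :: "real \<Rightarrow> rvec" where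
  "real_vec r = (\<lambda>i. if i = 0 then r else 0)"


subsection \<open>Directional derivatives\<close>

definition has_dir_deriv :: "(rvec \<Rightarrow> real) \<Rightarrow> rvec \<Rightarrow> rvec \<Rightarrow> real \<Rightarrow> bool" where
  "has_dir_deriv f x l d \<longleftrightarrow>
     ((\<lambda>t. (f (\<lambda>i. x i + t * l i) - f x) / t) \<longlongrightarrow> d) (at_right 0)"

definition dir_deriv :: "(rvec \<Rightarrow> real) \<Rightarrow> rvec \<Rightarrow> rvec \<Rightarrow> real" where
  "dir_deriv f x l = Lim (at_right 0) (\<lambda>t. (f (\<lambda>i. x i + t * l i) - f x) / t)"


subsection \<open>The projections along a unit vector\<close>

definition orth_compl :: "nat \<Rightarrow> rvec \<Rightarrow> rvec set" where
  "orth_compl n l = {v \<in> Rn n. (\<Sum>i<n. v i * l i) = 0}"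

definition is_projection :: "nat \<Rightarrow> rvec \<Rightarrow> (rvec \<Rightarrow> rvec) \<Rightarrow> bool" where
  "is_projection n l P \<longleftrightarrow>
     P \<in> Rn n \<rightarrow> Rn (n - 1) \<and>
     (\<forall>u\<in>Rn n. \<forall>v\<in>Rn n. \<forall>a b. P (\<lambda>i. a * u i + b * v i) = (\<lambda>i. a * P u i + b * P v i)) \<and>
     P ` orth_compl n l = Rn (n - 1) \<and>
     (\<forall>v\<in>orth_compl n l. L2_set (P v) {..<n - 1} = L2_set v {..<n}) \<and>
     P l = zero_vec"

text \<open>A choice \<open>pr n l\<close> of one such map for every dimension \<open>n \<ge> 2\<close> and every unit vector \<open>l\<close>.\<close>

definition projection_family :: "(nat \<Rightarrow> rvec \<Rightarrow> rvec \<Rightarrow> rvec) \<Rightarrow> bool" where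
  "projection_family pr \<longleftrightarrow> (\<forall>n\<ge>2. \<forall>l\<in>usphere n. is_projection n l (pr n l))"

text \<open>
  The transpose \<open>\<real>\<^sup>n\<^sup>-\<^sup>1 \<rightarrow> \<real>\<^sup>n\<close> of a linear map \<open>P : \<real>\<^sup>n \<rightarrow> \<real>\<^sup>n\<^sup>-\<^sup>1\<close>: column \<open>i\<close> of the matrix of \<open>P\<close> is
  the image of the \<open>i\<close>-th standard basis vector.
\<close>

definition transpose_map :: "nat \<Rightarrow> (rvec \<Rightarrow> rvec) \<Rightarrow> rvec \<Rightarrow> rvec" where
  "transpose_map n P y =
     (\<lambda>i. if i < n then \<Sum>j<n - 1. P (\<lambda>k. if k = i then 1 else 0) j * y j else 0)"

text \<open>The function \<open>f\<^sub>l = f'(x; l + \<Pi>\<^sup>T(\<cdot>))\<close> on \<open>\<real>\<^sup>n\<^sup>-\<^sup>1\<close>.\<close>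

definition restricted_deriv ::
  "(nat \<Rightarrow> rvec \<Rightarrow> rvec \<Rightarrow> rvec) \<Rightarrow> nat \<Rightarrow> (rvec \<Rightarrow> real) \<Rightarrow> rvec \<Rightarrow> rvec \<Rightarrow> rvec \<Rightarrow> real" where
  "restricted_deriv pr n f x l = (\<lambda>y. dir_deriv f x (\<lambda>i. l i + transpose_map n (pr n l) y i))"


subsection \<open>Directed subdifferentiability\<close>

text \<open>The dimension is at least one; nothing is specified in dimension zero.\<close>

fun M_directed_subdifferentiable ::
  "(nat \<Rightarrow> rvec \<Rightarrow> rvec \<Rightarrow> rvec) \<Rightarrow> real \<Rightarrow> nat \<Rightarrow> (rvec \<Rightarrow> real) \<Rightarrow> rvec \<Rightarrow> bool" where
  "M_directed_subdifferentiable pr M (Suc 0) f x \<longleftrightarrow>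
     (\<exists>d. has_dir_deriv f x (real_vec 1) d) \<and>
     (\<exists>d. has_dir_deriv f x (real_vec (-1)) d) \<and>
     max \<bar>dir_deriv f x (real_vec (-1))\<bar> \<bar>dir_deriv f x (real_vec 1)\<bar> \<le> M"
| "M_directed_subdifferentiable pr M (Suc (Suc k)) f x \<longleftrightarrow>
     (\<forall>l\<in>Rn (Suc (Suc k)). \<exists>d. has_dir_deriv f x l d) \<and>
     continuous_map (Euclidean_space (Suc (Suc k))) euclideanreal (dir_deriv f x) \<and>
     (\<forall>l\<in>usphere (Suc (Suc k)). \<bar>dir_deriv f x l\<bar> \<le> M) \<and>
     (\<forall>l\<in>usphere (Suc (Suc k)).
        M_directed_subdifferentiable pr M (Suc k)
          (restricted_deriv pr (Suc (Suc k)) f x l) zero_vec)"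

definition directed_subdifferentiable ::
  "(nat \<Rightarrow> rvec \<Rightarrow> rvec \<Rightarrow> rvec) \<Rightarrow> nat \<Rightarrow> (rvec \<Rightarrow> real) \<Rightarrow> rvec \<Rightarrow> bool" where
  "directed_subdifferentiable pr n f x \<longleftrightarrow> (\<exists>M\<ge>0. M_directed_subdifferentiable pr M n f x)"


subsection \<open>Directed sets\<close>

text \<open>
  \<open>DInterval a b\<close> is the directed interval from \<open>a\<close> to \<open>b\<close>, that is the pair
  \<open>(a\<^sub>1(-1), a\<^sub>1(1)) = (-a, b)\<close>.  \<open>DFamily A a\<close> is the family \<open>(A l, a l)\<close>; since it is indexed by the
  sphere only, both components carry a fixed dummy value at all other \<open>l\<close> (see \<open>sphere_family\<close>),
  so that equality of families is HOL equality.
\<close>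

datatype dirset = DInterval real real | DFamily "rvec \<Rightarrow> dirset" "rvec \<Rightarrow> real"

definition sphere_family :: "nat \<Rightarrow> (rvec \<Rightarrow> dirset) \<Rightarrow> (rvec \<Rightarrow> real) \<Rightarrow> dirset" where
  "sphere_family n A a =
     DFamily (\<lambda>l. if l \<in> usphere n then A l else DInterval 0 0) (\<lambda>l. if l \<in> usphere n then a l else 0)"

fun dirset_norm :: "nat \<Rightarrow> dirset \<Rightarrow> real" where
  "dirset_norm (Suc 0) (DInterval a b) = max \<bar>- a\<bar> \<bar>b\<bar>"
| "dirset_norm (Suc (Suc k)) (DFamily A a) =
     max (SUP l\<in>usphere (Suc (Suc k)). dirset_norm (Suc k) (A l)) (SUP l\<in>usphere (Suc (Suc k)). \<bar>a l\<bar>)"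

fun directed_sets :: "nat \<Rightarrow> dirset set" where
  "directed_sets (Suc 0) = {DInterval a b | a b. True}"
| "directed_sets (Suc (Suc k)) =
     {sphere_family (Suc (Suc k)) A a | A a.
        (\<forall>l\<in>usphere (Suc (Suc k)). A l \<in> directed_sets (Suc k)) \<and>
        bdd_above ((\<lambda>l. dirset_norm (Suc k) (A l)) ` usphere (Suc (Suc k))) \<and>
        continuous_map (nsphere (Suc k)) euclideanreal a}"

text \<open>
  The linear operations.  They respect the dummy values outside the sphere, and sums of directed
  sets of different dimensions are left unspecified.
\<close>

instantiation dirset :: "{plus, scaleR}"
begin

primrec plus_dirset :: "dirset \<Rightarrow> dirset \<Rightarrow> dirset" where
  "plus_dirset (DInterval a b) C =
     (case C of DInterval c d \<Rightarrow> DInterval (a + c) (b + d) | DFamily B b' \<Rightarrow> undefined)"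
| "plus_dirset (DFamily A a) C =
     (case C of DInterval c d \<Rightarrow> undefined
      | DFamily B b \<Rightarrow> DFamily (\<lambda>l. plus_dirset (A l) (B l)) (\<lambda>l. a l + b l))"

primrec scaleR_dirset :: "real \<Rightarrow> dirset \<Rightarrow> dirset" where
  "scaleR_dirset r (DInterval a b) = DInterval (r * a) (r * b)"
| "scaleR_dirset r (DFamily A a) = DFamily (\<lambda>l. scaleR_dirset r (A l)) (\<lambda>l. r * a l)"

instance ..

end


subsection \<open>The directed subdifferential\<close>

fun directed_subdifferential ::
  "(nat \<Rightarrow> rvec \<Rightarrow> rvec \<Rightarrow> rvec) \<Rightarrow> nat \<Rightarrow> (rvec \<Rightarrow> real) \<Rightarrow> rvec \<Rightarrow> dirset" where
  "directed_subdifferential pr (Suc 0) f x =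
     DInterval (- dir_deriv f x (real_vec (-1))) (dir_deriv f x (real_vec 1))"
| "directed_subdifferential pr (Suc (Suc k)) f x =
     sphere_family (Suc (Suc k))
       (\<lambda>l. directed_subdifferential pr (Suc k) (restricted_deriv pr (Suc (Suc k)) f x l) zero_vec)
       (dir_deriv f x)"

text \<open>The directed subdifferential is a directed set, with norm at most \<open>M\<close>.\<close>

lemma directed_subdifferential_bounded:
  assumes "M_directed_subdifferentiable pr M n f x" and "n \<ge> 1"
  shows "directed_subdifferential pr n f x \<in> directed_sets n \<and>
         dirset_norm n (directed_subdifferential pr n f x) \<le> M"
  using assms
proof (induction pr M n f x rule: M_directed_subdifferentiable.induct)
  case (1 pr M f x)
  then show ?case by auto
next
  case (2 pr M k f x)
  let ?n = "Suc (Suc k)"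
  let ?S = "usphere ?n"
  let ?A = "\<lambda>l. directed_subdifferential pr (Suc k) (restricted_deriv pr ?n f x l) zero_vec"
  have A: "?A l \<in> directed_sets (Suc k)" "dirset_norm (Suc k) (?A l) \<le> M" if "l \<in> ?S" for l
    using 2 that by simp_all
  have ne: "?S \<noteq> {}"
    using in_topspace_nsphere by blast
  have "continuous_map (nsphere (Suc k)) euclideanreal (dir_deriv f x)"
    unfolding nsphere_def using "2.prems"(1)
    by (intro continuous_map_from_subtopology) simp
  moreover have "bdd_above ((\<lambda>l. dirset_norm (Suc k) (?A l)) ` ?S)"
    using A(2) by (intro bdd_aboveI2)
  ultimately have "directed_subdifferential pr ?n f x \<in> directed_sets ?n"
    using A(1) by auto
  moreover have "(SUP l\<in>?S. dirset_norm (Suc k) (if l \<in> ?S then ?A l else DInterval 0 0)) \<le> M"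
    using A(2) by (intro cSUP_least ne) simp
  moreover have "(SUP l\<in>?S. \<bar>if l \<in> ?S then dir_deriv f x l else 0\<bar>) \<le> M"
    using "2.prems"(1) by (intro cSUP_least ne) simp
  ultimately show ?case
    by (simp add: sphere_family_def)
qed auto

end

theory Submission
  imports Defs
begin

text \<open>Difference quotients are linear in the function, so one-sided limits give h'(x;l) =
  \<alpha> f'(x;l) + \<beta> g'(x;l) for h = \<alpha> f + \<beta> g wherever both derivatives exist
  (\<open>dir_deriv_linear_combination\<close>). Applied to the directions l + \<Pi>^T y, this shows
  that the restricted function of h is the same combination of those of f and g
  (\<open>restricted_deriv_linear_combination\<close>). Hence the problem reproduces itself one
  dimension lower, and induction on the dimension applies. The bound M has to serve all l and all
  levels of the recursion at once, so the induction carries the explicit constant |\<alpha>| M +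
  |\<beta>| N (\<open>M_directed_subdifferentiable_linear_combination\<close>).\<close>

lemma has_dir_deriv_linear_combination:
  assumes "has_dir_deriv f x l d" and "has_dir_deriv g x l e"
  shows "has_dir_deriv (\<lambda>y. \<alpha> * f y + \<beta> * g y) x l (\<alpha> * d + \<beta> * e)"
proof -
  have "((\<lambda>t. \<alpha> * ((f (\<lambda>i. x i + t * l i) - f x) / t) + \<beta> * ((g (\<lambda>i. x i + t * l i) - g x) / t))
          \<longlongrightarrow> \<alpha> * d + \<beta> * e) (at_right 0)"
    using assms unfolding has_dir_deriv_def by (intro tendsto_intros)
  then show ?thesis
    unfolding has_dir_deriv_def by (simp add: algebra_simps add_divide_distrib diff_divide_distrib)
qed

lemma dir_deriv_eq:
  assumes "has_dir_deriv f x l d"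
  shows "dir_deriv f x l = d"
  using assms unfolding has_dir_deriv_def dir_deriv_def by (intro tendsto_Lim) simp_all

text \<open>\<open>dir_deriv\<close> is given by \<open>Lim\<close>, which is the limit only once
  convergence is known; hence the two existence assumptions.\<close>

lemma dir_deriv_linear_combination:
  assumes "\<exists>d. has_dir_deriv f x l d" and "\<exists>e. has_dir_deriv g x l e"
  shows "dir_deriv (\<lambda>y. \<alpha> * f y + \<beta> * g y) x l = \<alpha> * dir_deriv f x l + \<beta> * dir_deriv g x l"
proof -
  obtain d e where "has_dir_deriv f x l d" "has_dir_deriv g x l e"
    using assms by blast
  then show ?thesis
    using has_dir_deriv_linear_combination[of f x l d g e \<alpha> \<beta>] by (simp add: dir_deriv_eq)
qed

lemma usphere_subset_Rn: "n \<ge> 1 \<Longrightarrow> usphere n \<subseteq> Rn n"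
  by (auto simp: nsphere topspace_Euclidean_space)

text \<open>An equality of functions, for all \<open>y\<close> and not just those in the carrier, so
  that it can rewrite the function argument of the recursive definitions.\<close>

lemma restricted_deriv_linear_combination:
  assumes "n \<ge> 1" and "l \<in> usphere n"
    and "\<forall>v\<in>Rn n. \<exists>d. has_dir_deriv f x v d" and "\<forall>v\<in>Rn n. \<exists>d. has_dir_deriv g x v d"
  shows "restricted_deriv pr n (\<lambda>y. \<alpha> * f y + \<beta> * g y) x l =
         (\<lambda>y. \<alpha> * restricted_deriv pr n f x l y + \<beta> * restricted_deriv pr n g x l y)"
proof
  fix y
  \<comment> \<open>Both summands vanish from index \<open>n\<close> on: \<open>l\<close> because
    the sphere lies in the carrier, \<open>transpose_map\<close> by its cut-off.\<close>
  have "(\<lambda>i. l i + transpose_map n (pr n l) y i) \<in> Rn n"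
    using subsetD[OF usphere_subset_Rn[OF assms(1)] assms(2)]
    by (simp add: topspace_Euclidean_space transpose_map_def)
  then show "restricted_deriv pr n (\<lambda>y. \<alpha> * f y + \<beta> * g y) x l y =
      \<alpha> * restricted_deriv pr n f x l y + \<beta> * restricted_deriv pr n g x l y"
    unfolding restricted_deriv_def using assms(3,4) by (intro dir_deriv_linear_combination) auto
qed

lemma abs_linear_combination_le:
  fixes a b \<alpha> \<beta> M N :: real
  assumes "\<bar>a\<bar> \<le> M" and "\<bar>b\<bar> \<le> N"
  shows "\<bar>\<alpha> * a + \<beta> * b\<bar> \<le> \<bar>\<alpha>\<bar> * M + \<bar>\<beta>\<bar> * N"
proof -
  have "\<bar>\<alpha> * a + \<beta> * b\<bar> \<le> \<bar>\<alpha>\<bar> * \<bar>a\<bar> + \<bar>\<beta>\<bar> * \<bar>b\<bar>"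
    using abs_triangle_ineq[of "\<alpha> * a" "\<beta> * b"] by (simp add: abs_mult)
  also have "\<dots> \<le> \<bar>\<alpha>\<bar> * M + \<bar>\<beta>\<bar> * N"
    using assms by (intro add_mono mult_left_mono) auto
  finally show ?thesis .
qed

text \<open>The dummy values off the sphere are zero, so linear combinations preserve them.\<close>

lemma sphere_family_linear_combination:
  "\<alpha> *\<^sub>R sphere_family n A a + \<beta> *\<^sub>R sphere_family n B b =
   sphere_family n (\<lambda>l. \<alpha> *\<^sub>R A l + \<beta> *\<^sub>R B l) (\<lambda>l. \<alpha> * a l + \<beta> * b l)"
  by (auto simp: sphere_family_def fun_eq_iff)

lemma sphere_family_cong:
  assumes "\<And>l. l \<in> usphere n \<Longrightarrow> A l = B l" and "\<And>l. l \<in> usphere n \<Longrightarrow> a l = b l"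
  shows "sphere_family n A a = sphere_family n B b"
  using assms by (auto simp: sphere_family_def fun_eq_iff)

text \<open>Both claims descend through the same identity for restricted functions, so one induction
  proves them together. \<open>g\<close> is generalized because the induction hypothesis is applied
  to its restricted derivative.\<close>

lemma M_directed_subdifferentiable_linear_combination:
  assumes "M_directed_subdifferentiable pr M n f x" and "M_directed_subdifferentiable pr N n g x"
    and "n \<ge> 1"
  shows "M_directed_subdifferentiable pr (\<bar>\<alpha>\<bar> * M + \<bar>\<beta>\<bar> * N) n (\<lambda>y. \<alpha> * f y + \<beta> * g y) x \<and>
         directed_subdifferential pr n (\<lambda>y. \<alpha> * f y + \<beta> * g y) x =
           \<alpha> *\<^sub>R directed_subdifferential pr n f x + \<beta> *\<^sub>R directed_subdifferential pr n g x"
  using assms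
proof (induction pr M n f x arbitrary: g rule: M_directed_subdifferentiable.induct)
  case (1 pr M f x)
  let ?h = "\<lambda>y. \<alpha> * f y + \<beta> * g y"
  have ex: "\<exists>d. has_dir_deriv f x (real_vec s) d" "\<exists>e. has_dir_deriv g x (real_vec s) e"
    if "s = 1 \<or> s = - 1" for s
    using 1 that by auto
  have D: "dir_deriv ?h x (real_vec s) = \<alpha> * dir_deriv f x (real_vec s) + \<beta> * dir_deriv g x (real_vec s)"
    if "s = 1 \<or> s = - 1" for s
    by (rule dir_deriv_linear_combination[OF ex[OF that]])
  have E: "\<exists>d. has_dir_deriv ?h x (real_vec s) d" if "s = 1 \<or> s = - 1" for s
    using ex[OF that] has_dir_deriv_linear_combination by blast
  have "\<bar>dir_deriv ?h x (real_vec s)\<bar> \<le> \<bar>\<alpha>\<bar> * M + \<bar>\<beta>\<bar> * N" if "s = 1 \<or> s = - 1" for s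
    unfolding D[OF that] using 1 that by (intro abs_linear_combination_le) auto
  then show ?case
    using D E by (simp add: algebra_simps)
next
  case (2 pr M k f x)
  let ?n = "Suc (Suc k)"
  let ?h = "\<lambda>y. \<alpha> * f y + \<beta> * g y"
  have ex: "\<forall>v\<in>Rn ?n. \<exists>d. has_dir_deriv f x v d" "\<forall>v\<in>Rn ?n. \<exists>d. has_dir_deriv g x v d"
    using 2 by simp_all
  have D: "dir_deriv ?h x v = \<alpha> * dir_deriv f x v + \<beta> * dir_deriv g x v" if "v \<in> Rn ?n" for v
    using ex that by (intro dir_deriv_linear_combination) simp_all
  have S: "l \<in> Rn ?n" if "l \<in> usphere ?n" for l
    using usphere_subset_Rn that by fastforce
  have R: "restricted_deriv pr ?n ?h x l =
      (\<lambda>y. \<alpha> * restricted_deriv pr ?n f x l y + \<beta> * restricted_deriv pr ?n g x l y)"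
    if "l \<in> usphere ?n" for l
    using ex that by (intro restricted_deriv_linear_combination) auto
  have IH: "M_directed_subdifferentiable pr (\<bar>\<alpha>\<bar> * M + \<bar>\<beta>\<bar> * N) (Suc k)
        (restricted_deriv pr ?n ?h x l) zero_vec"
    "directed_subdifferential pr (Suc k) (restricted_deriv pr ?n ?h x l) zero_vec =
      \<alpha> *\<^sub>R directed_subdifferential pr (Suc k) (restricted_deriv pr ?n f x l) zero_vec +
      \<beta> *\<^sub>R directed_subdifferential pr (Suc k) (restricted_deriv pr ?n g x l) zero_vec"
    if "l \<in> usphere ?n" for l
    \<comment> \<open>After this rewriting the goals are the induction hypothesis for the restricted
      derivatives of \<open>f\<close> and \<open>g\<close> at the origin.\<close>
    unfolding R[OF that]
    using "2.IH"[OF that, of "restricted_deriv pr ?n g x l"] "2.prems" that by simp_all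
  have "\<exists>d. has_dir_deriv ?h x v d" if "v \<in> Rn ?n" for v
    using ex that has_dir_deriv_linear_combination by blast
  moreover have "continuous_map (Euclidean_space ?n) euclideanreal (dir_deriv ?h x)"
  proof -
    have "continuous_map (Euclidean_space ?n) euclideanreal
        (\<lambda>v. \<alpha> * dir_deriv f x v + \<beta> * dir_deriv g x v)"
      using "2.prems" by (intro continuous_intros) simp_all
    then show ?thesis
      \<comment> \<open>The formula for the derivative is known on the carrier, which is all that
        continuity on this space sees.\<close>
      by (rule continuous_map_eq) (simp add: D)
  qed
  moreover have "\<bar>dir_deriv ?h x l\<bar> \<le> \<bar>\<alpha>\<bar> * M + \<bar>\<beta>\<bar> * N" if "l \<in> usphere ?n" for l
    unfolding D[OF S[OF that]] using "2.prems" that by (intro abs_linear_combination_le) simp_all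
  ultimately have "M_directed_subdifferentiable pr (\<bar>\<alpha>\<bar> * M + \<bar>\<beta>\<bar> * N) ?n ?h x"
    using IH(1) by simp
  moreover have "directed_subdifferential pr ?n ?h x =
      \<alpha> *\<^sub>R directed_subdifferential pr ?n f x + \<beta> *\<^sub>R directed_subdifferential pr ?n g x"
    \<comment> \<open>Both sides are now sphere families, so it remains to compare components at
      unit vectors.\<close>
    unfolding directed_subdifferential.simps sphere_family_linear_combination
    using IH(2) D S by (intro sphere_family_cong) auto
  ultimately show ?case ..
qed auto

theorem proposition2p6:
  fixes n :: nat
    and pr :: "nat \<Rightarrow> (nat \<Rightarrow> real) \<Rightarrow> (nat \<Rightarrow> real) \<Rightarrow> (nat \<Rightarrow> real)"
    and f1 f2 :: "(nat \<Rightarrow> real) \<Rightarrow> real"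
    and x :: "nat \<Rightarrow> real"
    and \<alpha> \<beta> :: real
  assumes "n \<ge> 1"
    and "projection_family pr"
    and "x \<in> Rn n"
    and "directed_subdifferentiable pr n f1 x"
    and "directed_subdifferentiable pr n f2 x"
  shows "directed_subdifferentiable pr n (\<lambda>y. \<alpha> * f1 y + \<beta> * f2 y) x \<and>
         directed_subdifferential pr n (\<lambda>y. \<alpha> * f1 y + \<beta> * f2 y) x =
           \<alpha> *\<^sub>R directed_subdifferential pr n f1 x + \<beta> *\<^sub>R directed_subdifferential pr n f2 x"
proof -
  obtain M N where M: "M \<ge> 0" "M_directed_subdifferentiable pr M n f1 x"
    and N: "N \<ge> 0" "M_directed_subdifferentiable pr N n f2 x"
    using assms(4,5) unfolding directed_subdifferentiable_def by blast
  \<comment> \<open>Directed subdifferentiability asks for a nonnegative bound.\<close>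
  have "0 \<le> \<bar>\<alpha>\<bar> * M + \<bar>\<beta>\<bar> * N"
    using M(1) N(1) by simp
  then show ?thesis
    using M_directed_subdifferentiable_linear_combination[OF M(2) N(2) assms(1)]
    unfolding directed_subdifferentiable_def by blast
qed

end
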